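(* Let $\tau:\{0,1\}\to\{0,1\}^+$ be a one-to-one primitive substitution of constant length $p\ge2$ having a coincidence and such that $X_\tau$ is not finite. Consider $\{x,y\}\subseteq X_\tau$ such that $\pi(x)=\pi(y)$. (1) Assume $|\mathcal I^+(x)|=\infty$. If for infinitely many $i\in\mathcal I^+(x)$, $s_i(x)\ne s_i(y)$, then $(x,y)$ is a Li–Yorke pair; otherwise $(x,y)$ is an asymptotic pair. (2) Assume $|\mathcal I^+(x)|<\infty$. If $\tau(0)$ and $\tau(1)$ begin with the same letter then $(x,y)$ is an asymptotic pair; otherwise $(x,y)$ is either an asymptotic pair or a Li–Yorke pair, but not a distal pair.
   Context: $\mathbb N$ is the set of non-negative integers. A substitution is a map $\tau:A\to A^+$, where $A$ is a finite set (here $A=\{0,1\}$) and $A^+$ is the set of non-empty finite words over $A$; it is extended to $A^+$ and $A^{\mathbb Z}$ by concatenation (on $A^{\mathbb Z}$, $\tau(x)=\dots\tau(x_{-1}).\tau(x_0)\tau(x_1)\dots$, the dot preceding coordinate $0$). It has constant length $p$ if $|\tau(a)|=p$ for all $a\in A$, is one-to-one if $\tau(a)\neq\tau(b)$ for $a\ne b$ in $A$, and is primitive if there is $n$ such that $a$ appears in $\tau^n(b)$ for all $a,b\in A$. The shift is $T((x_i)_i)=(x_{i+1})_i$. $X_\tau$ is the smallest subshift (closed shift-invariant subset) of $A^{\mathbb Z}$ in which all words $\tau^n(a)$, $n\in\mathbb N$, $a\in A$, appear; fix a metric $\varrho$ compatible with its topology. Pairs: $\{x,y\}$ is distal if $\liminf_{n\to\infty}\varrho(T^nx,T^ny)>0$,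 proximal if this $\liminf$ is $0$, asymptotic if $\lim_{n\to\infty}\varrho(T^nx,T^ny)=0$, and Li–Yorke if it is proximal but not asymptotic. $\tau$ has a coincidence if there are $a\ne b$ in $A$ such that the words $\tau(a)$ and $\tau(b)$ agree in at least one coordinate. Expansion: by known results (Dekking, Mossé), when $X_\tau$ is infinite, $\tau:X_\tau\to\tau(X_\tau)$ is injective and $\{T^i(\tau(X_\tau)):0\le i\le p-1\}$ is a clopen partition of $X_\tau$. Hence for each $x\in X_\tau$ there are a unique sequence $(x^{(i)})_{i\in\mathbb N}$ in $X_\tau$ and a unique sequence $(\delta_i)_{i\in\mathbb N}$ in $\{0,\dots,p-1\}$ with $x^{(0)}=x$ and $x^{(i)}=T^{\delta_i}\tau(x^{(i+1)})$ for all $i\ge 0$. Put $\pi(x)=(\delta_i)_{i\in\mathbb N}$, $s_i(x)=x^{(i)}_1x^{(i)}_2\cdots x^{(i)}_{p-1-\delta_i}$ (the empty word if $\delta_i=p-1$), and $\mathcal I^+(x)=\{i\in\mathbb N:|s_i(x)|\ne0\}$. *)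

theory Defs
  imports "HOL-Analysis.Analysis" "HOL-Library.Z2"
begin

section \<open>Substitutions acting on words and on bi-infinite sequences\<close>

text \<open>The alphabet is the type \<^typ>\<open>'a\<close>, words are lists, and points of the full shift
  are functions \<^typ>\<open>int \<Rightarrow> 'a\<close>.\<close>

definition substitution :: "('a \<Rightarrow> 'a list) \<Rightarrow> bool" where
  "substitution \<tau> \<longleftrightarrow> (\<forall>a. \<tau> a \<noteq> [])"

definition constant_length :: "('a \<Rightarrow> 'a list) \<Rightarrow> nat \<Rightarrow> bool" where
  "constant_length \<tau> p \<longleftrightarrow> (\<forall>a. length (\<tau> a) = p)"

definition subst_word :: "('a \<Rightarrow> 'a list) \<Rightarrow> 'a list \<Rightarrow> 'a list" where
  "subst_word \<tau> w = concat (map \<tau> w)"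

definition primitive :: "('a \<Rightarrow> 'a list) \<Rightarrow> bool" where
  "primitive \<tau> \<longleftrightarrow> (\<exists>n. \<forall>a b. a \<in> set ((subst_word \<tau> ^^ n) [b]))"

definition coincidence :: "('a \<Rightarrow> 'a list) \<Rightarrow> bool" where
  "coincidence \<tau> \<longleftrightarrow>
     (\<exists>a b. a \<noteq> b \<and> (\<exists>j. j < length (\<tau> a) \<and> j < length (\<tau> b) \<and> \<tau> a ! j = \<tau> b ! j))"

text \<open>In \<open>\<dots>\<tau>(x\<^sub>-\<^sub>1).\<tau>(x\<^sub>0)\<tau>(x\<^sub>1)\<dots>\<close>, the block \<open>\<tau>(x\<^sub>k)\<close> occupies the coordinates from
  \<open>block_start \<tau> x k\<close> up to but excluding \<open>block_start \<tau> x (k + 1)\<close>.\<close>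

definition block_start :: "('a \<Rightarrow> 'a list) \<Rightarrow> (int \<Rightarrow> 'a) \<Rightarrow> int \<Rightarrow> int" where
  "block_start \<tau> x k =
     (if 0 \<le> k then (\<Sum>j\<in>{0..<k}. int (length (\<tau> (x j))))
      else - (\<Sum>j\<in>{k..<0}. int (length (\<tau> (x j)))))"

definition subst_seq :: "('a \<Rightarrow> 'a list) \<Rightarrow> (int \<Rightarrow> 'a) \<Rightarrow> (int \<Rightarrow> 'a)" where
  "subst_seq \<tau> x = (\<lambda>n.
     let k = (THE k. block_start \<tau> x k \<le> n \<and> n < block_start \<tau> x (k + 1))
     in \<tau> (x k) ! nat (n - block_start \<tau> x k))"

lemma subst_seq_constant_length:
  assumes "constant_length \<tau> p" "0 < p"
  shows "subst_seq \<tau> x n = \<tau> (x (n div int p)) ! nat (n mod int p)"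
proof -
  have bs: "block_start \<tau> x k = int p * k" for k
    using assms(1) by (simp add: block_start_def constant_length_def)
  have "(THE k. int p * k \<le> n \<and> n < int p * (k + 1)) = n div int p"
  proof (rule the_equality)
    show "int p * (n div int p) \<le> n \<and> n < int p * (n div int p + 1)"
    proof -
      have "0 \<le> n mod int p" "n mod int p < int p"
        using assms(2) by simp_all
      moreover have "n = int p * (n div int p) + n mod int p"
        by simp
      ultimately show ?thesis
        by (simp only: distrib_left mult_1_right) linarith
    qed
  next
    fix k assume "int p * k \<le> n \<and> n < int p * (k + 1)"
    then show "k = n div int p"
      by (intro int_div_pos_eq[symmetric, where r = "n - int p * k"]) (auto simp: algebra_simps)
  qed
  then show ?thesis
    by (simp add: subst_seq_def bs minus_mult_div_eq_mod)
qed

section \<open>Substitution subshifts\<close>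

definition shift :: "(int \<Rightarrow> 'a) \<Rightarrow> (int \<Rightarrow> 'a)" where
  "shift x = (\<lambda>i. x (i + 1))"

definition full_shift :: "(int \<Rightarrow> 'a) topology" where
  "full_shift = product_topology (\<lambda>_. discrete_topology UNIV) UNIV"

text \<open>For two-sided sequences shift-invariance means invariance under the shift and its inverse.\<close>

definition subshift :: "(int \<Rightarrow> 'a) set \<Rightarrow> bool" where
  "subshift X \<longleftrightarrow> closedin full_shift X \<and> shift ` X = X"

definition appears_in :: "'a list \<Rightarrow> (int \<Rightarrow> 'a) \<Rightarrow> bool" where
  "appears_in w x \<longleftrightarrow> (\<exists>k. \<forall>j<length w. x (k + int j) = w ! j)"

definition subst_shift :: "('a \<Rightarrow> 'a list) \<Rightarrow> (int \<Rightarrow> 'a) set" where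
  "subst_shift \<tau> =
     \<Inter>{X. subshift X \<and> (\<forall>n a. \<exists>x\<in>X. appears_in ((subst_word \<tau> ^^ n) [a]) x)}"

definition compatible_metric ::
    "(int \<Rightarrow> 'a) set \<Rightarrow> ((int \<Rightarrow> 'a) \<Rightarrow> (int \<Rightarrow> 'a) \<Rightarrow> real) \<Rightarrow> bool" where
  "compatible_metric X \<rho> \<longleftrightarrow>
     Metric_space X \<rho> \<and> Metric_space.mtopology X \<rho> = subtopology full_shift X"

section \<open>Distal, proximal, asymptotic and Li--Yorke pairs\<close>

definition distal_pair ::
    "((int \<Rightarrow> 'a) \<Rightarrow> (int \<Rightarrow> 'a) \<Rightarrow> real) \<Rightarrow> (int \<Rightarrow> 'a) \<Rightarrow> (int \<Rightarrow> 'a) \<Rightarrow> bool" where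
  "distal_pair \<rho> x y \<longleftrightarrow> liminf (\<lambda>n. ereal (\<rho> ((shift ^^ n) x) ((shift ^^ n) y))) > 0"

definition proximal_pair ::
    "((int \<Rightarrow> 'a) \<Rightarrow> (int \<Rightarrow> 'a) \<Rightarrow> real) \<Rightarrow> (int \<Rightarrow> 'a) \<Rightarrow> (int \<Rightarrow> 'a) \<Rightarrow> bool" where
  "proximal_pair \<rho> x y \<longleftrightarrow> liminf (\<lambda>n. ereal (\<rho> ((shift ^^ n) x) ((shift ^^ n) y))) = 0"

definition asymptotic_pair ::
    "((int \<Rightarrow> 'a) \<Rightarrow> (int \<Rightarrow> 'a) \<Rightarrow> real) \<Rightarrow> (int \<Rightarrow> 'a) \<Rightarrow> (int \<Rightarrow> 'a) \<Rightarrow> bool" where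
  "asymptotic_pair \<rho> x y \<longleftrightarrow> (\<lambda>n. \<rho> ((shift ^^ n) x) ((shift ^^ n) y)) \<longlonglongrightarrow> 0"

definition Li_Yorke_pair ::
    "((int \<Rightarrow> 'a) \<Rightarrow> (int \<Rightarrow> 'a) \<Rightarrow> real) \<Rightarrow> (int \<Rightarrow> 'a) \<Rightarrow> (int \<Rightarrow> 'a) \<Rightarrow> bool" where
  "Li_Yorke_pair \<rho> x y \<longleftrightarrow> proximal_pair \<rho> x y \<and> \<not> asymptotic_pair \<rho> x y"

section \<open>The expansion of a point\<close>

definition is_expansion ::
    "('a \<Rightarrow> 'a list) \<Rightarrow> nat \<Rightarrow> (int \<Rightarrow> 'a) \<Rightarrow> (nat \<Rightarrow> int \<Rightarrow> 'a) \<Rightarrow> (nat \<Rightarrow> nat) \<Rightarrow> bool" where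
  "is_expansion \<tau> p x xs \<delta> \<longleftrightarrow>
     xs 0 = x \<and> (\<forall>i. xs i \<in> subst_shift \<tau> \<and> \<delta> i < p \<and>
                      xs i = (shift ^^ \<delta> i) (subst_seq \<tau> (xs (Suc i))))"

text \<open>For a one-to-one primitive \<open>\<tau>\<close> of constant length \<open>p\<close> with infinite \<open>subst_shift \<tau>\<close>, every
  point of \<open>subst_shift \<tau>\<close> has exactly one expansion (Dekking, Mosse), so that the choice
  below is no choice.\<close>

definition expansion ::
    "('a \<Rightarrow> 'a list) \<Rightarrow> nat \<Rightarrow> (int \<Rightarrow> 'a) \<Rightarrow> (nat \<Rightarrow> int \<Rightarrow> 'a) \<times> (nat \<Rightarrow> nat)" where
  "expansion \<tau> p x = (SOME (xs, \<delta>). is_expansion \<tau> p x xs \<delta>)"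

definition desubst :: "('a \<Rightarrow> 'a list) \<Rightarrow> nat \<Rightarrow> (int \<Rightarrow> 'a) \<Rightarrow> nat \<Rightarrow> (int \<Rightarrow> 'a)" where
  "desubst \<tau> p x = fst (expansion \<tau> p x)"

definition address :: "('a \<Rightarrow> 'a list) \<Rightarrow> nat \<Rightarrow> (int \<Rightarrow> 'a) \<Rightarrow> nat \<Rightarrow> nat" where
  "address \<tau> p x = snd (expansion \<tau> p x)"

text \<open>The word \<open>s\<^sub>i(x)\<close> is read off \<open>x\<^sup>(\<^sup>i\<^sup>)\<close> at the coordinates \<open>1, \<dots>, p - 1 - \<delta>\<^sub>i\<close>; the interval
  is one of integers and is empty if \<open>\<delta>\<^sub>i = p - 1\<close>.\<close>

definition suffix_word :: "('a \<Rightarrow> 'a list) \<Rightarrow> nat \<Rightarrow> nat \<Rightarrow> (int \<Rightarrow> 'a) \<Rightarrow> 'a list" where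
  "suffix_word \<tau> p i x = map (desubst \<tau> p x i) [1..int p - 1 - int (address \<tau> p x i)]"

definition I_plus :: "('a \<Rightarrow> 'a list) \<Rightarrow> nat \<Rightarrow> (int \<Rightarrow> 'a) \<Rightarrow> nat set" where
  "I_plus \<tau> p x = {i. length (suffix_word \<tau> p i x) \<noteq> 0}"

end

theory Submission
  imports Defs
begin

text \<open>Write \<open>S\<close> for the action of \<open>\<tau>\<close> on bi-infinite sequences and \<open>\<delta>\<close> for the common digit sequence
  of \<open>x\<close> and \<open>y\<close>. For every \<open>m\<close> the point \<open>x\<close> is a shift of \<open>S\<^sup>m(x\<^sup>(\<^sup>m\<^sup>))\<close>, and the amount of the shift depends on
  \<open>\<delta>\<close> only. So \<open>x\<close> and \<open>y\<close> are cut at the same places into blocks of length \<open>p\<^sup>m\<close>, the blocks being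
  \<open>\<tau>\<^sup>m\<close> of the letters of \<open>x\<^sup>(\<^sup>m\<^sup>)\<close> and \<open>y\<^sup>(\<^sup>m\<^sup>)\<close>. The block over coordinate \<open>1\<close> begins at
  \<open>t\<^sub>m = 1 + (\<Sum>l<m. (p - 1 - \<delta>\<^sub>l) p\<^sup>l) > 0\<close> (\<open>tail_start\<close> below), and the coordinates from \<open>t\<^sub>m\<close> up to but
  excluding \<open>t\<^sub>m\<^sub>+\<^sub>1\<close> carry the word \<open>\<tau>\<^sup>m(s\<^sub>m)\<close>. Everything is decided by comparing blocks.

  \<^item> On two letters a coincidence is a column in which \<open>\<tau>\<close> is constant. Hence any two blocks of
  level \<open>m + 1\<close> share a subblock of length \<open>p\<^sup>m\<close> in the same position. Applied to the blocks that
  begin at \<open>t\<^sub>m\<^sub>+\<^sub>1\<close> this shows that \<open>x\<close> and \<open>y\<close> agree on arbitrarily long intervals of positive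
  coordinates (\<open>long_agreement\<close>), so the pair is always proximal and never distal. It only
  remains to tell whether \<open>x\<close> and \<open>y\<close> agree from some coordinate on.

  \<^item> If \<open>\<I>\<^sup>+(x)\<close> is infinite, then \<open>t\<^sub>m\<close> tends to infinity. If \<open>s\<^sub>m(x) \<noteq> s\<^sub>m(y)\<close>, injectivity of \<open>\<tau>\<close> gives
  a difference at or after \<open>t\<^sub>m\<close> (\<open>differ_if_block_differs\<close>). If \<open>s\<^sub>m(x) = s\<^sub>m(y)\<close> for all large \<open>m\<close>, the
  words \<open>\<tau>\<^sup>m(s\<^sub>m)\<close> exhaust a right half-line on which \<open>x = y\<close> (\<open>tail_agrees_if_suffixes_agree\<close>).

  \<^item> If \<open>\<I>\<^sup>+(x)\<close> is finite, then \<open>t\<^sub>m\<close> is eventually constant, equal to some \<open>t\<close>, and \<open>x\<close> read from \<open>t\<close>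
  begins with \<open>\<tau>\<^sup>m(x\<^sup>(\<^sup>m\<^sup>)\<^sub>1)\<close> for all large \<open>m\<close>. Here \<open>x\<^sup>(\<^sup>m\<^sup>)\<^sub>1\<close> is the first letter of an image under \<open>\<tau>\<close>.
  If the two images begin alike, \<open>x\<close> and \<open>y\<close> agree from \<open>t\<close> on (\<open>tail_agrees_if_first_letters_agree\<close>).

  That points have expansions is a compactness argument. The substitution shift is the set of
  sequences all of whose windows occur in some \<open>\<tau>\<^sup>n(b)\<close> (\<open>subst_shift_eq_language_shift\<close>), and the
  union of the sets \<open>T\<^sup>\<delta>(S(X\<^sub>\<tau>))\<close> with \<open>0 \<le> \<delta> < p\<close> is a subshift that contains all these words, so
  it contains \<open>X\<^sub>\<tau>\<close> by minimality (\<open>language_shift_desubstitute\<close>). Compactness also makes any compatible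
  metric uniformly comparable with agreement on windows, which turns the statements about
  coordinates into statements about distances.\<close>

instance bit :: finite
proof
  have "(UNIV :: bit set) = {0, 1}"
    by (auto intro: bit.exhaust)
  then show "finite (UNIV :: bit set)"
    by (metis finite.emptyI finite_insert)
qed

section \<open>The topology and the metrics of the full shift\<close>

definition translate :: "int \<Rightarrow> (int \<Rightarrow> 'a) \<Rightarrow> (int \<Rightarrow> 'a)" where
  "translate d x = (\<lambda>i. x (i + d))"

lemma shift_funpow: "(shift ^^ n) x = translate (int n) x"
  by (induction n) (auto simp: shift_def translate_def algebra_simps)

lemma subshift_translate:
  assumes "subshift X" "x \<in> X"
  shows "translate d x \<in> X"
proof (induction d rule: int_induct [where k = 0])
  case base
  then show ?case using assms by (simp add: translate_def)
next
  case (step1 d)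
  have "translate (d + 1) x = shift (translate d x)"
    by (simp add: translate_def shift_def algebra_simps)
  then show ?case using step1 assms(1) by (auto simp: subshift_def)
next
  case (step2 d)
  obtain u where u: "u \<in> X" "translate d x = shift u"
    using step2 assms(1) by (auto simp: subshift_def)
  have "translate (d - 1) x i = u i" for i
    using fun_cong[OF u(2), of "i - 1"] by (simp add: translate_def shift_def algebra_simps)
  then have "translate (d - 1) x = u" by auto
  then show ?case using u by simp
qed

lemma subshiftI:
  assumes "closedin full_shift X" "\<And>x d. x \<in> X \<Longrightarrow> translate d x \<in> X"
  shows "subshift X"
proof -
  have "shift x \<in> X" if "x \<in> X" for x
    using assms(2)[OF that, of 1] by (simp add: translate_def shift_def)
  moreover have "x \<in> shift ` X" if "x \<in> X" for x
    by (rule image_eqI[OF _ assms(2)[OF that, of "-1"]]) (simp add: translate_def shift_def)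
  ultimately show ?thesis
    using assms(1) by (auto simp: subshift_def)
qed

lemma topspace_full_shift [simp]: "topspace full_shift = UNIV"
  by (simp add: full_shift_def)

text \<open>A condition on finitely many coordinates is both open and closed, because each coordinate
  carries the discrete topology.\<close>

lemma window_dependent_openin:
  assumes "\<And>x y. x \<in> U \<Longrightarrow> (\<And>i. \<bar>i\<bar> \<le> int k \<Longrightarrow> y i = x i) \<Longrightarrow> y \<in> U"
  shows "openin full_shift U"
  unfolding full_shift_def openin_product_topology_alt
proof
  fix x assume "x \<in> U"
  define V where "V i = (if \<bar>i\<bar> \<le> int k then {x i} else UNIV)" for i
  have "{i \<in> UNIV. V i \<noteq> topspace (discrete_topology UNIV)} \<subseteq> {- int k..int k}"
    by (auto simp: V_def split: if_splits)
  then have "finite {i \<in> UNIV. V i \<noteq> topspace (discrete_topology UNIV)}"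
    by (rule finite_subset) simp
  moreover have "Pi\<^sub>E UNIV V \<subseteq> U"
  proof
    fix y assume y: "y \<in> Pi\<^sub>E UNIV V"
    have "y i = x i" if "\<bar>i\<bar> \<le> int k" for i
      using PiE_mem[OF y, of i] that by (simp add: V_def)
    then show "y \<in> U" using assms \<open>x \<in> U\<close> by blast
  qed
  ultimately show "\<exists>V. finite {i \<in> UNIV. V i \<noteq> topspace (discrete_topology UNIV)} \<and>
      (\<forall>i\<in>UNIV. openin (discrete_topology UNIV) (V i)) \<and> x \<in> Pi\<^sub>E UNIV V \<and> Pi\<^sub>E UNIV V \<subseteq> U"
    by (intro exI[of _ V]) (auto simp: V_def)
qed

lemma window_dependent_closedin:
  assumes "\<And>x y. x \<in> C \<Longrightarrow> (\<And>i. \<bar>i\<bar> \<le> int k \<Longrightarrow> y i = x i) \<Longrightarrow> y \<in> C"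
  shows "closedin full_shift C"
proof -
  have "openin full_shift (- C)"
  proof (rule window_dependent_openin[where k = k])
    show "y \<in> - C" if "x \<in> - C" "\<And>i. \<bar>i\<bar> \<le> int k \<Longrightarrow> y i = x i" for x y
      using assms[of y x] that by auto
  qed
  then show ?thesis by (simp add: closedin_def Compl_eq_Diff_UNIV)
qed

lemma openin_contains_window:
  assumes "openin full_shift U" "x \<in> U"
  obtains k where "\<And>y. (\<And>i. \<bar>i\<bar> \<le> int k \<Longrightarrow> y i = x i) \<Longrightarrow> y \<in> U"
proof -
  obtain V where fin: "finite {i. V i \<noteq> UNIV}" and x: "x \<in> Pi\<^sub>E UNIV V" and V: "Pi\<^sub>E UNIV V \<subseteq> U"
    using assms by (auto simp: full_shift_def openin_product_topology_alt)
  define k where "k = Max (insert 0 ((\<lambda>i. nat \<bar>i\<bar>) ` {i. V i \<noteq> UNIV}))"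
  have k: "\<bar>i\<bar> \<le> int k" if "V i \<noteq> UNIV" for i
  proof -
    have "nat \<bar>i\<bar> \<le> k" unfolding k_def using that fin by (intro Max_ge) auto
    then show ?thesis by simp
  qed
  have "y \<in> U" if "\<And>i. \<bar>i\<bar> \<le> int k \<Longrightarrow> y i = x i" for y
  proof -
    have "y i \<in> V i" for i
      using that[of i] k[of i] PiE_mem[OF x, of i] by (cases "V i = UNIV") auto
    then show ?thesis using V by auto
  qed
  then show ?thesis by (rule that)
qed

lemma closedin_windows_imp_mem:
  assumes "closedin full_shift X" "\<And>k. \<exists>z\<in>X. \<forall>i. \<bar>i\<bar> \<le> int k \<longrightarrow> z i = x i"
  shows "x \<in> X"
proof (rule ccontr)
  assume "x \<notin> X"
  moreover have "openin full_shift (- X)"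
    using assms(1) by (simp add: closedin_def Compl_eq_Diff_UNIV)
  ultimately obtain k where k: "\<And>y. (\<And>i. \<bar>i\<bar> \<le> int k \<Longrightarrow> y i = x i) \<Longrightarrow> y \<in> - X"
    using openin_contains_window[of "- X" x] by auto
  then show False using assms(2)[of k] by blast
qed

lemma compact_space_full_shift: "compact_space (full_shift :: (int \<Rightarrow> 'a::finite) topology)"
  by (simp add: full_shift_def compact_space_product_topology compact_space_discrete_topology)

lemma Hausdorff_space_full_shift: "Hausdorff_space full_shift"
  by (simp add: full_shift_def Hausdorff_space_product_topology)

text \<open>The radius of the window must not depend on the points, since it is used along whole orbits.
  Every ball of radius \<open>\<epsilon>/2\<close> contains a cylinder around its centre; finitely many of these
  cylinders cover the compact space, and the largest of their radii works everywhere.\<close>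

lemma compatible_metric_small_if_window:
  fixes X :: "(int \<Rightarrow> 'a::finite) set"
  assumes "closedin full_shift X" "compatible_metric X \<rho>" "0 < \<epsilon>"
  obtains L :: nat where
    "\<And>u v. u \<in> X \<Longrightarrow> v \<in> X \<Longrightarrow> (\<And>i. \<bar>i\<bar> \<le> int L \<Longrightarrow> u i = v i) \<Longrightarrow> \<rho> u v < \<epsilon>"
proof -
  interpret Metric_space X \<rho> using assms(2) by (simp add: compatible_metric_def)
  have top: "mtopology = subtopology full_shift X"
    using assms(2) by (simp add: compatible_metric_def)
  have "\<exists>k::nat. \<forall>v\<in>X. (\<forall>i. \<bar>i\<bar> \<le> int k \<longrightarrow> v i = u i) \<longrightarrow> \<rho> u v < \<epsilon> / 2" if u: "u \<in> X" for u
  proof -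
    obtain U where U: "openin full_shift U" "mball u (\<epsilon> / 2) = U \<inter> X"
      using openin_mball[of u "\<epsilon> / 2"] by (auto simp: top openin_subtopology)
    have "u \<in> U" using U(2) u assms(3) by (metis IntD1 centre_in_mball_iff half_gt_zero)
    then obtain k where "\<And>y. (\<And>i. \<bar>i\<bar> \<le> int k \<Longrightarrow> y i = u i) \<Longrightarrow> y \<in> U"
      using openin_contains_window[OF U(1)] by metis
    then have "\<forall>v\<in>X. (\<forall>i. \<bar>i\<bar> \<le> int k \<longrightarrow> v i = u i) \<longrightarrow> v \<in> mball u (\<epsilon> / 2)"
      using U(2) by auto
    then show ?thesis by (intro exI[of _ k]) auto
  qed
  then obtain k :: "(int \<Rightarrow> 'a) \<Rightarrow> nat" where
    k: "\<And>u v. u \<in> X \<Longrightarrow> v \<in> X \<Longrightarrow> (\<And>i. \<bar>i\<bar> \<le> int (k u) \<Longrightarrow> v i = u i) \<Longrightarrow> \<rho> u v < \<epsilon> / 2"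
    by metis
  define C where "C u = {v. \<forall>i. \<bar>i\<bar> \<le> int (k u) \<longrightarrow> v i = u i}" for u
  have "compactin full_shift X"
    using assms(1) by (simp add: closedin_compact_space compact_space_full_shift)
  moreover have "openin full_shift (C u)" for u
    by (rule window_dependent_openin[where k = "k u"]) (auto simp: C_def)
  moreover have "X \<subseteq> \<Union>(C ` X)" by (auto simp: C_def)
  ultimately obtain \<F> where \<F>: "finite \<F>" "\<F> \<subseteq> C ` X" "X \<subseteq> \<Union>\<F>"
    unfolding compactin_def by (metis (no_types, lifting) imageE)
  then obtain F where F: "finite F" "F \<subseteq> X" "\<F> = C ` F"
    by (meson finite_subset_image)
  define L where "L = Max (insert 0 (k ` F))"
  have "\<rho> v w < \<epsilon>" if "v \<in> X" "w \<in> X" and agree: "\<And>i. \<bar>i\<bar> \<le> int L \<Longrightarrow> v i = w i" for v w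
  proof -
    obtain u where u: "u \<in> F" "v \<in> C u" using \<F> F \<open>v \<in> X\<close> by auto
    have "k u \<le> L" unfolding L_def using F u by (intro Max_ge) auto
    then have wv: "w i = v i" if "\<bar>i\<bar> \<le> int (k u)" for i using agree[of i] that by auto
    have "\<rho> u v < \<epsilon> / 2" using k[of u v] u F that by (auto simp: C_def)
    moreover have "\<rho> u w < \<epsilon> / 2" using k[of u w] u F that wv by (auto simp: C_def)
    moreover have "\<rho> v w \<le> \<rho> v u + \<rho> u w" using triangle[of v u w] u F that by auto
    ultimately show ?thesis using commute[of u v] by simp
  qed
  then show ?thesis by (rule that)
qed

text \<open>A Lebesgue number of the open cover by the sets of points with a given letter at the origin.\<close>

lemma compatible_metric_separates_letters:
  fixes X :: "(int \<Rightarrow> 'a::finite) set"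
  assumes "closedin full_shift X" "compatible_metric X \<rho>"
  obtains \<epsilon> where "0 < \<epsilon>" "\<And>u v. u \<in> X \<Longrightarrow> v \<in> X \<Longrightarrow> \<rho> u v < \<epsilon> \<Longrightarrow> u 0 = v 0"
proof -
  interpret Metric_space X \<rho> using assms(2) by (simp add: compatible_metric_def)
  have top: "mtopology = subtopology full_shift X"
    using assms(2) by (simp add: compatible_metric_def)
  define U where "U a = X \<inter> {u. u 0 = a}" for a
  have "openin full_shift {u :: int \<Rightarrow> 'a. u 0 = a}" for a
    by (rule window_dependent_openin[where k = 0]) auto
  then have "openin mtopology (U a)" for a
    by (auto simp: top U_def openin_subtopology_Int2)
  moreover have "compactin mtopology X"
    using assms(1) by (simp add: top compactin_subtopology closedin_compact_space compact_space_full_shift)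
  moreover have "X \<subseteq> \<Union>(range U)" by (auto simp: U_def)
  ultimately obtain \<epsilon> where \<epsilon>: "0 < \<epsilon>" "\<forall>u\<in>X. \<exists>V\<in>range U. mball u \<epsilon> \<subseteq> V"
    using lebesgue_number[of X "range U"] by auto
  have "u 0 = v 0" if uv: "u \<in> X" "v \<in> X" "\<rho> u v < \<epsilon>" for u v
  proof -
    obtain a where a: "mball u \<epsilon> \<subseteq> U a" using \<epsilon>(2) uv(1) by auto
    have "u \<in> mball u \<epsilon>" "v \<in> mball u \<epsilon>" using uv \<epsilon>(1) by auto
    then have "u \<in> U a" "v \<in> U a" using a by blast+
    then show ?thesis by (simp add: U_def)
  qed
  then show ?thesis using \<epsilon>(1) that by blast
qed

text \<open>The next three lemmas replace the metric notions by agreement of coordinates, for points of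
  any subshift over a finite alphabet.\<close>

lemma asymptotic_pair_if_eventually_agree:
  fixes X :: "(int \<Rightarrow> 'a::finite) set"
  assumes "subshift X" "compatible_metric X \<rho>" "x \<in> X" "y \<in> X" "\<And>n. N \<le> n \<Longrightarrow> x n = y n"
  shows "asymptotic_pair \<rho> x y"
  unfolding asymptotic_pair_def shift_funpow
proof (rule LIMSEQ_I)
  interpret Metric_space X \<rho> using assms(2) by (simp add: compatible_metric_def)
  fix \<epsilon> :: real assume "0 < \<epsilon>"
  then obtain L :: nat where L:
    "\<And>u v. u \<in> X \<Longrightarrow> v \<in> X \<Longrightarrow> (\<And>i. \<bar>i\<bar> \<le> int L \<Longrightarrow> u i = v i) \<Longrightarrow> \<rho> u v < \<epsilon>"
    using compatible_metric_small_if_window assms(1,2) unfolding subshift_def by metis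
  have "\<rho> (translate (int n) x) (translate (int n) y) < \<epsilon>" if "nat N + L \<le> n" for n
  proof (rule L)
    show "translate (int n) x \<in> X" "translate (int n) y \<in> X"
      using assms(1,3,4) by (simp_all add: subshift_translate)
    show "translate (int n) x i = translate (int n) y i" if "\<bar>i\<bar> \<le> int L" for i
      unfolding translate_def by (rule assms(5)) (use that \<open>nat N + L \<le> n\<close> in linarith)
  qed
  then show "\<exists>no. \<forall>n\<ge>no. norm (\<rho> (translate (int n) x) (translate (int n) y) - 0) < \<epsilon>"
    by (intro exI[of _ "nat N + L"]) (auto simp: nonneg)
qed

lemma not_asymptotic_pair_if_frequently_differ:
  fixes X :: "(int \<Rightarrow> 'a::finite) set"
  assumes "subshift X" "compatible_metric X \<rho>" "x \<in> X" "y \<in> X" "\<And>N. \<exists>n\<ge>N. x n \<noteq> y n"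
  shows "\<not> asymptotic_pair \<rho> x y"
proof
  assume asym: "asymptotic_pair \<rho> x y"
  obtain \<epsilon> where \<epsilon>: "0 < \<epsilon>" "\<And>u v. u \<in> X \<Longrightarrow> v \<in> X \<Longrightarrow> \<rho> u v < \<epsilon> \<Longrightarrow> u 0 = v 0"
    using compatible_metric_separates_letters assms(1,2) unfolding subshift_def by metis
  obtain N where N: "\<And>n. N \<le> n \<Longrightarrow> \<rho> (translate (int n) x) (translate (int n) y) < \<epsilon>"
    using LIMSEQ_D[OF asym[unfolded asymptotic_pair_def shift_funpow] \<epsilon>(1)] by fastforce
  obtain n where n: "int N \<le> n" "x n \<noteq> y n" using assms(5) by blast
  have "\<rho> (translate n x) (translate n y) < \<epsilon>" using N[of "nat n"] n(1) by simp
  then have "translate n x 0 = translate n y 0"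
    using \<epsilon>(2) subshift_translate assms(1,3,4) by blast
  then show False using n(2) by (simp add: translate_def)
qed

text \<open>Times going to infinity come from the lengths of the intervals alone: an interval of agreement
  of length \<open>N + 2L + 1\<close> contains a window of radius \<open>L\<close> whose centre lies beyond \<open>N\<close>.\<close>

lemma proximal_pair_if_long_agreement:
  fixes X :: "(int \<Rightarrow> 'a::finite) set"
  assumes "subshift X" "compatible_metric X \<rho>" "x \<in> X" "y \<in> X"
    and "\<And>l. \<exists>a\<ge>0. \<forall>n. a \<le> n \<and> n < a + int l \<longrightarrow> x n = y n"
  shows "proximal_pair \<rho> x y"
proof -
  interpret Metric_space X \<rho> using assms(2) by (simp add: compatible_metric_def)
  define f where "f n = ereal (\<rho> (translate (int n) x) (translate (int n) y))" for n
  have "0 \<le> liminf f"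
    by (rule Liminf_bounded) (simp add: f_def nonneg)
  moreover have "\<not> 0 < liminf f"
  proof
    assume "0 < liminf f"
    then obtain c where "0 < c" "c < liminf f" using dense by blast
    then have ev: "eventually (\<lambda>n. c < f n) sequentially"
      by (metis less_LiminfD)
    obtain N where N: "\<And>n. N \<le> n \<Longrightarrow> c < f n"
      using ev by (auto simp: eventually_sequentially)
    have "c < f N" using N by simp
    then obtain \<epsilon> where \<epsilon>: "c = ereal \<epsilon>" "0 < \<epsilon>"
      using \<open>0 < c\<close> by (cases c) (auto simp: f_def)
    then obtain L :: nat where L:
      "\<And>u v. u \<in> X \<Longrightarrow> v \<in> X \<Longrightarrow> (\<And>i. \<bar>i\<bar> \<le> int L \<Longrightarrow> u i = v i) \<Longrightarrow> \<rho> u v < \<epsilon>"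
      using compatible_metric_small_if_window assms(1,2) unfolding subshift_def by metis
    obtain a where a: "0 \<le> a" "\<And>n. a \<le> n \<Longrightarrow> n < a + int (N + 2 * L + 1) \<Longrightarrow> x n = y n"
      using assms(5)[of "N + 2 * L + 1"] by blast
    \<comment> \<open>The window of radius \<open>L\<close> around \<open>n\<close> starts at \<open>a + N\<close> and ends at \<open>a + N + 2L\<close>.\<close>
    define n where "n = nat a + N + L"
    have "\<rho> (translate (int n) x) (translate (int n) y) < \<epsilon>"
    proof (rule L)
      show "translate (int n) x \<in> X" "translate (int n) y \<in> X"
        using assms(1,3,4) by (simp_all add: subshift_translate)
      show "translate (int n) x i = translate (int n) y i" if "\<bar>i\<bar> \<le> int L" for i
        unfolding translate_def by (rule a(2)) (use that \<open>0 \<le> a\<close> in \<open>auto simp: n_def\<close>)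
    qed
    moreover have "c < f n" using N by (simp add: n_def)
    ultimately show False by (simp add: f_def \<epsilon>)
  qed
  ultimately show ?thesis
    by (auto simp: proximal_pair_def shift_funpow f_def[abs_def])
qed

section \<open>Blocks of a substitution of constant length\<close>

locale constant_length_substitution =
  fixes \<tau> :: "'a::finite \<Rightarrow> 'a list" and p :: nat
  assumes two_le_p: "2 \<le> p" and len: "constant_length \<tau> p"
begin

abbreviation P :: int where "P \<equiv> int p"

abbreviation S :: "(int \<Rightarrow> 'a) \<Rightarrow> (int \<Rightarrow> 'a)" where "S \<equiv> subst_seq \<tau>"

lemma P_pos [simp]: "0 < P" "0 < P ^ m"
  using two_le_p by auto

lemma S_eq: "S x n = \<tau> (x (n div P)) ! nat (n mod P)"
  using subst_seq_constant_length[OF len] two_le_p by simp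

text \<open>Kept as a rule for the fully applied iterate, so that rewriting peels off one level of blocks
  and leaves the inner iterate folded.\<close>

lemma S_iterate_Suc: "(S ^^ Suc m) u i = \<tau> ((S ^^ m) u (i div P)) ! nat (i mod P)"
  using S_eq[of "(S ^^ m) u" i] by simp

lemma exponent_less_power: "int m < P ^ m"
proof -
  have "m < 2 ^ m" by (rule less_exp)
  also have "\<dots> \<le> p ^ m" using two_le_p by (rule power_mono) simp
  finally show ?thesis by (metis of_nat_less_iff of_nat_power)
qed

lemma S_translate: "S (translate d x) = translate (P * d) (S x)"
proof
  show "S (translate d x) n = translate (P * d) (S x) n" for n
    using two_le_p by (simp add: S_eq translate_def add.commute)
qed

lemma S_iterate_translate: "(S ^^ m) (translate d x) = translate (P ^ m * d) ((S ^^ m) x)"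
  by (induction m) (simp_all add: S_translate algebra_simps)

text \<open>In \<open>S\<^sup>m(u)\<close> the letter \<open>u\<^sub>q\<close> governs the coordinates \<open>i\<close> with \<open>i div p\<^sup>m = q\<close>, and the entry at \<open>i\<close> is
  determined by this letter and by the position \<open>i mod p\<^sup>m\<close> inside the block.\<close>

lemma S_iterate_block:
  assumes "u (i div P ^ m) = v (j div P ^ m)" "i mod P ^ m = j mod P ^ m"
  shows "(S ^^ m) u i = (S ^^ m) v j"
  using assms
proof (induction m arbitrary: i j)
  case (Suc m)
  have eq: "k mod P ^ Suc m = P * (k div P mod P ^ m) + k mod P" for k
    by (simp add: zmod_zmult2_eq)
  have "k mod P ^ Suc m mod P = k mod P" for k
    unfolding eq by simp
  then have "i mod P = j mod P"
    using Suc.prems(2) by metis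
  moreover from this have "i div P mod P ^ m = j div P mod P ^ m"
    using Suc.prems(2) two_le_p unfolding eq by simp
  moreover have "u (i div P div P ^ m) = v (j div P div P ^ m)"
    using Suc.prems(1) by (simp add: zdiv_zmult2_eq)
  ultimately show ?case unfolding S_iterate_Suc by (simp add: Suc.IH)
qed simp

text \<open>Different letters have images under \<open>\<tau>\<close> of the same length that differ in some column; this
  propagates a difference from each level to the next.\<close>

lemma S_iterate_block_differs:
  assumes "inj \<tau>" "u j \<noteq> v j"
  shows "\<exists>i. i div P ^ m = j \<and> (S ^^ m) u i \<noteq> (S ^^ m) v i"
proof (induction m)
  case 0
  then show ?case using assms(2) by simp
next
  case (Suc m)
  then obtain i where i: "i div P ^ m = j" "(S ^^ m) u i \<noteq> (S ^^ m) v i" by blast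
  then have "\<tau> ((S ^^ m) u i) \<noteq> \<tau> ((S ^^ m) v i)" using assms(1) by (simp add: inj_eq)
  moreover have "length (\<tau> a) = p" for a using len by (simp add: constant_length_def)
  ultimately obtain r where r: "r < p" "\<tau> ((S ^^ m) u i) ! r \<noteq> \<tau> ((S ^^ m) v i) ! r"
    by (auto simp: list_eq_iff_nth_eq)
  define n where "n = i * P + int r"
  have n: "n div P = i" "n mod P = int r" using r(1) by (simp_all add: n_def)
  then have "n div P ^ Suc m = j" using i(1) by (simp add: zdiv_zmult2_eq)
  then show ?case using r n by (intro exI[of _ n]) (simp add: S_iterate_Suc del: funpow.simps)
qed

text \<open>The words \<open>\<tau>\<^sup>n(a)\<close> are handled as the first \<open>p\<^sup>n\<close> coordinates of \<open>S\<^sup>n\<close> applied to the constant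
  sequence \<open>a\<close>. This makes the block lemmas above available for words as well.\<close>

lemma length_subst_word: "length (subst_word \<tau> w) = length w * p"
  using len by (induction w) (simp_all add: subst_word_def constant_length_def)

lemma nth_subst_word: "i < length w * p \<Longrightarrow> subst_word \<tau> w ! i = \<tau> (w ! (i div p)) ! (i mod p)"
proof (induction w arbitrary: i)
  case (Cons a w)
  show ?case
  proof (cases "i < p")
    case True
    then show ?thesis using len by (simp add: subst_word_def constant_length_def nth_append)
  next
    case False
    then have "i div p = Suc ((i - p) div p)" "i mod p = (i - p) mod p"
      using two_le_p by (simp_all add: le_div_geq le_mod_geq)
    then show ?thesis using False Cons len
      by (simp add: subst_word_def constant_length_def nth_append)
  qed
qed simp

lemma subst_word_iterate_nth:
  "length ((subst_word \<tau> ^^ n) [a]) = p ^ n \<and>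
   (\<forall>i < p ^ n. (subst_word \<tau> ^^ n) [a] ! i = (S ^^ n) (\<lambda>_. a) (int i))"
proof (induction n)
  case (Suc n)
  show ?case
  proof (intro conjI allI impI)
    show "length ((subst_word \<tau> ^^ Suc n) [a]) = p ^ Suc n"
      using Suc by (simp add: length_subst_word)
    fix i assume i: "i < p ^ Suc n"
    have "i div p < p ^ n" using i two_le_p by (simp add: less_mult_imp_div_less mult.commute)
    then show "(subst_word \<tau> ^^ Suc n) [a] ! i = (S ^^ Suc n) (\<lambda>_. a) (int i)"
      using i Suc unfolding S_iterate_Suc
      by (simp add: nth_subst_word mult.commute flip: zdiv_int zmod_int)
  qed
qed simp

lemma appears_in_iff:
  "appears_in ((subst_word \<tau> ^^ n) [a]) x \<longleftrightarrow>
     (\<exists>q. \<forall>j. 0 \<le> j \<and> j < P ^ n \<longrightarrow> x (q + j) = (S ^^ n) (\<lambda>_. a) j)"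
proof -
  have "(\<forall>j < p ^ n. x (q + int j) = (S ^^ n) (\<lambda>_. a) (int j)) \<longleftrightarrow>
      (\<forall>j. 0 \<le> j \<and> j < P ^ n \<longrightarrow> x (q + j) = (S ^^ n) (\<lambda>_. a) j)" (is "?l \<longleftrightarrow> ?r") for q
  proof
    assume l: ?l
    show ?r
    proof (intro allI impI)
      fix j assume "0 \<le> j \<and> j < P ^ n"
      then have "nat j < p ^ n" "int (nat j) = j" by (auto simp: nat_less_iff)
      then show "x (q + j) = (S ^^ n) (\<lambda>_. a) j" using l by metis
    qed
  next
    assume ?r
    then show ?l by (metis of_nat_0_le_iff of_nat_less_iff of_nat_power)
  qed
  then show ?thesis
    using subst_word_iterate_nth[of n a] by (simp add: appears_in_def)
qed

section \<open>The substitution shift and its language\<close>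

text \<open>The word is \<open>\<tau>\<^sup>n(b)\<close>, read as a stretch of a sequence, and \<open>s\<close> is the place in it of the centre of the
  window; the two bounds keep the window inside the word.\<close>

definition window_in_language :: "nat \<Rightarrow> (int \<Rightarrow> 'a) \<Rightarrow> bool" where
  "window_in_language k x \<longleftrightarrow> (\<exists>n b s. int k \<le> s \<and> s + int k < P ^ n \<and>
      (\<forall>i. \<bar>i\<bar> \<le> int k \<longrightarrow> x i = (S ^^ n) (\<lambda>_. b) (s + i)))"

definition language_shift :: "(int \<Rightarrow> 'a) set" where
  "language_shift = (\<Inter>k. {x. window_in_language k x})"

text \<open>Only the coordinates in a window enter.\<close>

lemma window_in_language_closedin: "closedin full_shift {x. window_in_language k x}"
proof (rule window_dependent_closedin[where k = k])
  show "y \<in> {x. window_in_language k x}"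
    if "x \<in> {x. window_in_language k x}" "\<And>i. \<bar>i\<bar> \<le> int k \<Longrightarrow> y i = x i" for x y
    using that by (fastforce simp: window_in_language_def)
qed

lemma window_in_language_mono:
  assumes "window_in_language l x" "k \<le> l"
  shows "window_in_language k x"
proof -
  obtain n b s where "int l \<le> s" "s + int l < P ^ n"
    "\<forall>i. \<bar>i\<bar> \<le> int l \<longrightarrow> x i = (S ^^ n) (\<lambda>_. b) (s + i)"
    using assms(1) by (auto simp: window_in_language_def)
  then show ?thesis
    unfolding window_in_language_def using assms(2) by (intro exI[of _ n] exI[of _ b] exI[of _ s]) auto
qed

text \<open>For each radius some long \<open>\<tau>\<^sup>n(b)\<close> has a factor of the required length; the sets of sequences
  with an admissible window are nested and closed in a compact space.\<close>

lemma language_shift_nonempty: "language_shift \<noteq> {}"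
  unfolding language_shift_def
proof (rule compact_space_imp_nest[OF compact_space_full_shift window_in_language_closedin])
  show "decseq (\<lambda>k. {x. window_in_language k x})"
    unfolding decseq_def using window_in_language_mono by blast
  show "{x. window_in_language k x} \<noteq> {}" for k
  proof -
    have "window_in_language k (\<lambda>i. (S ^^ (2 * k)) (\<lambda>_. undefined) (int k + i))"
      unfolding window_in_language_def
      using exponent_less_power[of "2 * k"] by (intro exI[of _ "2 * k"] exI[of _ undefined] exI[of _ "int k"]) auto
    then show ?thesis by blast
  qed
qed

lemma language_shift_subshift: "subshift language_shift"
proof (rule subshiftI)
  show "closedin full_shift language_shift"
    unfolding language_shift_def using window_in_language_closedin by (intro closedin_INT) auto
  show "translate d x \<in> language_shift" if x: "x \<in> language_shift" for x d
  proof -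
    have "window_in_language k (translate d x)" for k
    proof -
      have "window_in_language (k + nat \<bar>d\<bar>) x" using x by (simp add: language_shift_def)
      then obtain n b s where s: "int k + \<bar>d\<bar> \<le> s" "s + (int k + \<bar>d\<bar>) < P ^ n"
        and w: "\<And>i. \<bar>i\<bar> \<le> int k + \<bar>d\<bar> \<Longrightarrow> x i = (S ^^ n) (\<lambda>_. b) (s + i)"
        by (auto simp: window_in_language_def)
      have "\<forall>i. \<bar>i\<bar> \<le> int k \<longrightarrow> translate d x i = (S ^^ n) (\<lambda>_. b) (s + d + i)"
        using w by (simp add: translate_def algebra_simps)
      moreover have "int k \<le> s + d" "s + d + int k < P ^ n" using s by linarith+
      ultimately show ?thesis unfolding window_in_language_def by blast
    qed
    then show ?thesis by (simp add: language_shift_def)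
  qed
qed

text \<open>A window of a point of the language shift is a factor of some \<open>\<tau>\<^sup>n(b)\<close>, hence of some point of
  \<open>X\<close>, which can be shifted into place; \<open>X\<close> is closed.\<close>

lemma language_shift_minimal:
  assumes "subshift X" "\<And>n a. \<exists>x\<in>X. appears_in ((subst_word \<tau> ^^ n) [a]) x"
  shows "language_shift \<subseteq> X"
proof
  fix x assume x: "x \<in> language_shift"
  show "x \<in> X"
  proof (rule closedin_windows_imp_mem)
    show "closedin full_shift X" using assms(1) by (simp add: subshift_def)
    fix k
    have "window_in_language k x" using x by (simp add: language_shift_def)
    then obtain n b s where s: "int k \<le> s" "s + int k < P ^ n"
      and w: "\<And>i. \<bar>i\<bar> \<le> int k \<Longrightarrow> x i = (S ^^ n) (\<lambda>_. b) (s + i)"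
      by (auto simp: window_in_language_def)
    obtain z q where z: "z \<in> X" "\<And>j. 0 \<le> j \<Longrightarrow> j < P ^ n \<Longrightarrow> z (q + j) = (S ^^ n) (\<lambda>_. b) j"
      using assms(2)[of n b] by (auto simp: appears_in_iff)
    have "translate (q + s) z i = x i" if "\<bar>i\<bar> \<le> int k" for i
      using z(2)[of "s + i"] w[OF that] that s by (simp add: translate_def algebra_simps)
    then show "\<exists>z\<in>X. \<forall>i. \<bar>i\<bar> \<le> int k \<longrightarrow> z i = x i"
      using subshift_translate[OF assms(1) z(1)] by blast
  qed
qed

text \<open>The window of radius \<open>k\<close> of \<open>S(x)\<close> is read off the image of the window of radius \<open>k\<close> of \<open>x\<close>,
  because \<open>i div p\<close> is no further from \<open>0\<close> than \<open>i\<close>. A factor of \<open>\<tau>\<^sup>n(b)\<close> turns into one of \<open>\<tau>\<^sup>n\<^sup>+\<^sup>1(b)\<close>.\<close>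

lemma S_language_shift:
  assumes "x \<in> language_shift"
  shows "S x \<in> language_shift"
proof -
  have "window_in_language k (S x)" for k
  proof -
    have "window_in_language k x" using assms by (simp add: language_shift_def)
    then obtain n b s where s: "int k \<le> s" "s + int k < P ^ n"
      and w: "\<And>i. \<bar>i\<bar> \<le> int k \<Longrightarrow> x i = (S ^^ n) (\<lambda>_. b) (s + i)"
      by (auto simp: window_in_language_def)
    have "S x i = (S ^^ Suc n) (\<lambda>_. b) (s * P + i)" if i: "\<bar>i\<bar> \<le> int k" for i
    proof -
      have "- int k \<le> i div P"
      proof -
        have "- int k * P \<le> - int k * 1"
          by (rule mult_left_mono_neg) (use two_le_p in auto)
        then have "- int k * P \<le> i" using i by linarith
        then have "(- int k * P) div P \<le> i div P" by (rule zdiv_mono1) (use two_le_p in simp)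
        moreover have "(- int k * P) div P = - int k"
          by (rule nonzero_mult_div_cancel_right) (use two_le_p in simp)
        ultimately show ?thesis by simp
      qed
      moreover have "i div P \<le> int k"
      proof (cases "0 \<le> i")
        case True
        then have "i div P \<le> i div 1" by (rule zdiv_mono2) (use two_le_p in auto)
        then show ?thesis using i by simp
      next
        case False
        then have "i div P < 0" using P_pos(1) by (subst pos_imp_zdiv_neg_iff) linarith+
        then show ?thesis by linarith
      qed
      ultimately have "x (i div P) = (S ^^ n) (\<lambda>_. b) (s + i div P)" using w by simp
      then show ?thesis using two_le_p unfolding S_iterate_Suc by (simp add: S_eq)
    qed
    moreover have "int k \<le> s * P"
    proof -
      have "s * 1 \<le> s * P" using s two_le_p by (intro mult_left_mono) auto
      then show ?thesis using s by simp
    qed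
    moreover have "s * P + int k < P ^ Suc n"
    proof -
      have "(s + int k + 1) * P \<le> P ^ n * P" using s by (intro mult_right_mono) auto
      moreover have "int k * 1 \<le> int k * P" using two_le_p by (intro mult_left_mono) auto
      ultimately show ?thesis using P_pos(1) by (simp add: algebra_simps del: P_pos)
    qed
    ultimately show ?thesis unfolding window_in_language_def by blast
  qed
  then show ?thesis by (simp add: language_shift_def)
qed

text \<open>Let every letter occur in \<open>\<tau>\<^sup>l(b)\<close> for every \<open>b\<close>. A window whose radius is the length of the
  blocks of level \<open>n + l\<close> contains a whole such block, say over the letter \<open>e\<close>. The letter \<open>a\<close> occurs
  in \<open>\<tau>\<^sup>l(e)\<close>, hence \<open>\<tau>\<^sup>n(a)\<close> occurs in that block.\<close>

lemma language_shift_contains_words: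
  assumes "primitive \<tau>" "x \<in> language_shift"
  shows "appears_in ((subst_word \<tau> ^^ n) [a]) x"
proof -
  obtain l where l: "\<And>a b. a \<in> set ((subst_word \<tau> ^^ l) [b])"
    using assms(1) by (auto simp: primitive_def)
  define k where "k = p ^ (n + l)"
  have k: "int k = P ^ (n + l)" by (simp add: k_def)
  have "window_in_language k x" using assms(2) by (simp add: language_shift_def)
  then obtain N b s where s: "int k \<le> s" "s + int k < P ^ N"
    and w: "\<And>i. \<bar>i\<bar> \<le> int k \<Longrightarrow> x i = (S ^^ N) (\<lambda>_. b) (s + i)"
    by (auto simp: window_in_language_def)
  have "P ^ (n + l) < P ^ N" using s P_pos(2)[of "n + l"] unfolding k by linarith
  then have "n + l < N" using two_le_p by (subst (asm) power_strict_increasing_iff) auto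
  then obtain q where q: "N = n + l + q" by (metis less_imp_add_positive)
  \<comment> \<open>Block \<open>j\<close> of level \<open>n + l\<close> is the one that contains the centre \<open>s\<close> of the window.\<close>
  define v where "v = (S ^^ q) (\<lambda>_. b)"
  define j where "j = s div P ^ (n + l)"
  obtain r where r: "r < p ^ l" "(S ^^ l) (\<lambda>_. v j) (int r) = a"
    using l[of a "v j"] subst_word_iterate_nth[of l "v j"] by (auto simp: in_set_conv_nth)
  have rP: "int r < P ^ l" using r(1) by (metis of_nat_less_iff of_nat_power)
  have a: "(S ^^ l) v (j * P ^ l + int r) = a"
  proof -
    have "(j * P ^ l + int r) div P ^ l = j"
      by (rule int_div_pos_eq[where r = "int r"]) (use rP in \<open>auto simp: mult.commute\<close>)
    moreover have "(j * P ^ l + int r) mod P ^ l = int r mod P ^ l" by simp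
    ultimately have "(S ^^ l) v (j * P ^ l + int r) = (S ^^ l) (\<lambda>_. v j) (int r)"
      by (intro S_iterate_block) auto
    then show ?thesis using r(2) by simp
  qed
  \<comment> \<open>The copy of \<open>\<tau>\<^sup>n(a)\<close> begins at \<open>c\<close>; the bounds say that it lies inside the window around \<open>s\<close>.\<close>
  define c where "c = (j * P ^ l + int r) * P ^ n"
  have bounds: "\<bar>c + t - s\<bar> \<le> int k" if t: "0 \<le> t" "t < P ^ n" for t
  proof -
    have s_eq: "s = j * P ^ (n + l) + s mod P ^ (n + l)" unfolding j_def by (simp only: div_mult_mod_eq)
    have sm: "0 \<le> s mod P ^ (n + l)" "s mod P ^ (n + l) < P ^ (n + l)"
      by (rule pos_mod_sign[OF P_pos(2)], rule pos_mod_bound[OF P_pos(2)])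
    have "(int r + 1) * P ^ n \<le> P ^ l * P ^ n" using rP P_pos(2)[of n] by (intro mult_right_mono) linarith+
    then have "int r * P ^ n + P ^ n \<le> P ^ (n + l)" by (simp add: algebra_simps power_add)
    moreover have "0 \<le> int r * P ^ n" by simp
    moreover have "c = j * P ^ (n + l) + int r * P ^ n" by (simp add: c_def algebra_simps power_add)
    ultimately show ?thesis using s_eq sm t unfolding k by linarith
  qed
  have "x (c - s + t) = (S ^^ n) (\<lambda>_. a) t" if t: "0 \<le> t" "t < P ^ n" for t
  proof -
    have "x (c - s + t) = (S ^^ N) (\<lambda>_. b) (c + t)"
      using w[of "c - s + t"] bounds[OF t] by (simp add: algebra_simps)
    also have "\<dots> = (S ^^ n) ((S ^^ l) v) (c + t)"
      by (simp add: q v_def funpow_add)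
    also have "\<dots> = (S ^^ n) (\<lambda>_. a) t"
    proof (rule S_iterate_block)
      have "(c + t) div P ^ n = j * P ^ l + int r"
        by (rule int_div_pos_eq[where r = t]) (use t in \<open>auto simp: c_def mult.commute\<close>)
      then show "(S ^^ l) v ((c + t) div P ^ n) = a" using a by simp
      show "(c + t) mod P ^ n = t mod P ^ n" by (simp add: c_def)
    qed
    finally show ?thesis .
  qed
  then show ?thesis by (auto simp: appears_in_iff)
qed

lemma subst_shift_eq_language_shift:
  assumes "primitive \<tau>"
  shows "subst_shift \<tau> = language_shift"
proof
  show "subst_shift \<tau> \<subseteq> language_shift"
    unfolding subst_shift_def
    using language_shift_subshift language_shift_nonempty language_shift_contains_words[OF assms]
    by blast
  show "language_shift \<subseteq> subst_shift \<tau>"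
    unfolding subst_shift_def using language_shift_minimal by blast
qed

lemma continuous_map_translate_S: "continuous_map full_shift full_shift (\<lambda>u. translate d (S u))"
proof -
  have "continuous_map full_shift (discrete_topology UNIV)
      ((\<lambda>a. \<tau> a ! nat ((k + d) mod P)) \<circ> (\<lambda>u. u ((k + d) div P)))" for k
    unfolding full_shift_def
    by (rule continuous_map_compose[OF continuous_map_product_projection]) auto
  then show ?thesis
    by (subst (2) full_shift_def) (simp add: continuous_map_componentwise_UNIV S_eq translate_def o_def)
qed

text \<open>The set of the sequences \<open>T\<^sup>\<delta>(S(u))\<close> is a subshift: it is closed as a finite union of continuous images of a
  compact set, and it is invariant because a shift by \<open>p\<close> can be pulled through \<open>S\<close>. It contains
  all words \<open>\<tau>\<^sup>n(a)\<close>, as every point \<open>S(u)\<close> does, and so contains the language shift.\<close>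

lemma language_shift_desubstitute:
  assumes "primitive \<tau>" "x \<in> language_shift"
  shows "\<exists>\<delta> < p. \<exists>u \<in> language_shift. x = (shift ^^ \<delta>) (S u)"
proof -
  define Y where "Y = (\<Union>\<delta> \<in> {..<p}. (\<lambda>u. translate (int \<delta>) (S u)) ` language_shift)"
  \<comment> \<open>Residues suffice for \<open>d\<close>: the multiple of \<open>p\<close> in \<open>d\<close> is absorbed by shifting \<open>u\<close>.\<close>
  have Y: "translate d (S u) \<in> Y" if "u \<in> language_shift" for u d
  proof -
    have "translate d (S u) = translate (d mod P) (translate (P * (d div P)) (S u))"
      by (simp add: translate_def algebra_simps)
    also have "\<dots> = translate (int (nat (d mod P))) (S (translate (d div P) u))"
      using pos_mod_sign[OF P_pos(1), of d] by (simp add: S_translate)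
    finally show ?thesis
      unfolding Y_def using subshift_translate[OF language_shift_subshift that] two_le_p
      by (auto simp: nat_less_iff intro!: bexI[of _ "nat (d mod P)"])
  qed
  have "subshift Y"
  proof (rule subshiftI)
    have "compactin full_shift language_shift"
      using language_shift_subshift
      by (simp add: subshift_def closedin_compact_space compact_space_full_shift)
    then have "closedin full_shift ((\<lambda>u. translate (int \<delta>) (S u)) ` language_shift)" for \<delta>
      by (intro compactin_imp_closedin Hausdorff_space_full_shift
          image_compactin[OF _ continuous_map_translate_S])
    then show "closedin full_shift Y" unfolding Y_def by (intro closedin_Union) auto
    fix z d assume "z \<in> Y"
    then obtain \<delta> u where u: "u \<in> language_shift" "z = translate (int \<delta>) (S u)"
      by (auto simp: Y_def)
    have "translate d z = translate (int \<delta> + d) (S u)"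
      by (simp add: u translate_def algebra_simps)
    then show "translate d z \<in> Y" using Y[OF u(1)] by simp
  qed
  moreover have "\<exists>z\<in>Y. appears_in ((subst_word \<tau> ^^ n) [a]) z" for n a
  proof -
    obtain u where u: "u \<in> language_shift" using language_shift_nonempty by blast
    have "S u \<in> Y" using Y[OF u, of 0] by (simp add: translate_def)
    then show ?thesis using language_shift_contains_words[OF assms(1) S_language_shift[OF u]] by blast
  qed
  ultimately have "x \<in> Y" using language_shift_minimal assms(2) by blast
  then show ?thesis by (auto simp: Y_def shift_funpow)
qed

text \<open>Iterating desubstitution gives one expansion of each point, and the choice operator in the
  definition of \<^const>\<open>expansion\<close> therefore picks a genuine one.\<close>

lemma expansion_exists:
  assumes "primitive \<tau>" "x \<in> subst_shift \<tau>"
  shows "is_expansion \<tau> p x (desubst \<tau> p x) (address \<tau> p x)"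
proof -
  have L: "subst_shift \<tau> = language_shift" using assms(1) by (rule subst_shift_eq_language_shift)
  have "\<forall>x\<in>language_shift. \<exists>\<delta> u. \<delta> < p \<and> u \<in> language_shift \<and> x = (shift ^^ \<delta>) (S u)"
    using language_shift_desubstitute[OF assms(1)] by blast
  then obtain d f where df: "\<And>x. x \<in> language_shift \<Longrightarrow>
      d x < p \<and> f x \<in> language_shift \<and> x = (shift ^^ d x) (S (f x))"
    by metis
  have mem: "(f ^^ i) x \<in> language_shift" for i
    using assms(2) df by (induction i) (auto simp: L)
  then have "is_expansion \<tau> p x (\<lambda>i. (f ^^ i) x) (\<lambda>i. d ((f ^^ i) x))"
    using df by (simp add: is_expansion_def L)
  then have "\<exists>e. (\<lambda>(xs, \<delta>). is_expansion \<tau> p x xs \<delta>) e" by auto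
  then have "(\<lambda>(xs, \<delta>). is_expansion \<tau> p x xs \<delta>) (expansion \<tau> p x)"
    unfolding expansion_def by (rule someI_ex)
  then show ?thesis by (simp add: desubst_def address_def case_prod_beta)
qed

section \<open>Pairs of points with the same expansion digits\<close>

text \<open>If \<open>\<delta>\<close> is the digit sequence of \<open>x\<close>, the block of \<open>x\<close> of level \<open>m\<close> over the letter \<open>x\<^sup>(\<^sup>m\<^sup>)\<^sub>1\<close> begins at
  this coordinate. In other words it is \<open>p\<^sup>m - (\<Sum>l<m. \<delta>\<^sub>l p\<^sup>l)\<close>; the form chosen here shows that it is
  positive and increases exactly at the indices in \<open>\<I>\<^sup>+(x)\<close>.\<close>

definition tail_start :: "(nat \<Rightarrow> nat) \<Rightarrow> nat \<Rightarrow> int" where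
  "tail_start \<delta> m = 1 + (\<Sum>l<m. (P - 1 - int (\<delta> l)) * P ^ l)"

lemma tail_start_Suc: "tail_start \<delta> (Suc m) = tail_start \<delta> m + (P - 1 - int (\<delta> m)) * P ^ m"
  by (simp add: tail_start_def)

lemma tail_start_mono:
  assumes "\<forall>l. \<delta> l < p" "m \<le> n"
  shows "tail_start \<delta> m \<le> tail_start \<delta> n"
proof -
  have "tail_start \<delta> l \<le> tail_start \<delta> (Suc l)" for l
    using spec[OF assms(1), of l] by (simp add: tail_start_Suc)
  then show ?thesis using assms(2) by (rule lift_Suc_mono_le)
qed

lemma tail_start_pos:
  assumes "\<forall>l. \<delta> l < p"
  shows "0 < tail_start \<delta> m"
  using tail_start_mono[OF assms, of 0 m] by (simp add: tail_start_def)

lemma tail_start_unbounded: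
  assumes "\<forall>l. \<delta> l < p" "infinite {l. \<delta> l < p - 1}"
  shows "\<exists>m. int N \<le> tail_start \<delta> m"
proof (induction N)
  case 0
  then show ?case using tail_start_pos[OF assms(1), of 0] by (intro exI[of _ 0]) simp
next
  case (Suc N)
  then obtain m where m: "int N \<le> tail_start \<delta> m" by blast
  obtain l where l: "m \<le> l" "\<delta> l < p - 1"
    using assms(2) by (auto simp: infinite_nat_iff_unbounded_le)
  have "1 * 1 \<le> (P - 1 - int (\<delta> l)) * P ^ l"
    using l(2) P_pos(2)[of l] by (intro mult_mono) linarith+
  then have "tail_start \<delta> l + 1 \<le> tail_start \<delta> (Suc l)" by (simp add: tail_start_Suc)
  then show ?case using m tail_start_mono[OF assms(1) l(1)] by (intro exI[of _ "Suc l"]) simp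
qed

lemma translate_translate: "translate a (translate b u) = translate (a + b) u"
  by (simp add: translate_def algebra_simps)

lemma expansion_iterate:
  assumes "is_expansion \<tau> p x xs \<delta>"
  shows "x n = (S ^^ m) (xs m) (n - tail_start \<delta> m + P ^ m)"
proof -
  have "x = translate (P ^ m - tail_start \<delta> m) ((S ^^ m) (xs m))"
  proof (induction m)
    case 0
    have "xs 0 = x" using assms unfolding is_expansion_def by blast
    then show ?case by (simp add: tail_start_def translate_def)
  next
    case (Suc m)
    have "xs m = translate (int (\<delta> m)) (S (xs (Suc m)))"
      using assms unfolding is_expansion_def shift_funpow by blast
    then have "(S ^^ m) (xs m) = translate (P ^ m * int (\<delta> m)) ((S ^^ m) (S (xs (Suc m))))"
      by (simp only: S_iterate_translate)
    also have "(S ^^ m) (S (xs (Suc m))) = (S ^^ Suc m) (xs (Suc m))"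
      by (simp only: funpow_Suc_right o_apply)
    finally have "x = translate (P ^ m - tail_start \<delta> m + P ^ m * int (\<delta> m))
        ((S ^^ Suc m) (xs (Suc m)))"
      using Suc by (simp only: translate_translate)
    moreover have "P ^ m - tail_start \<delta> m + P ^ m * int (\<delta> m) = P ^ Suc m - tail_start \<delta> (Suc m)"
      by (simp add: tail_start_Suc algebra_simps)
    ultimately show ?case by (simp only:)
  qed
  then have "x n = translate (P ^ m - tail_start \<delta> m) ((S ^^ m) (xs m)) n" by (rule fun_cong)
  then show ?thesis by (simp add: translate_def algebra_simps)
qed

lemma expansion_step:
  assumes "is_expansion \<tau> p x xs \<delta>"
  shows "xs i n = \<tau> (xs (Suc i) ((n + int (\<delta> i)) div P)) ! nat ((n + int (\<delta> i)) mod P)"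
proof -
  have "xs i = translate (int (\<delta> i)) (S (xs (Suc i)))"
    using assms unfolding is_expansion_def shift_funpow by blast
  then have "xs i n = translate (int (\<delta> i)) (S (xs (Suc i))) n" by (rule fun_cong)
  then show ?thesis by (simp add: translate_def S_eq)
qed

context
  fixes x y :: "int \<Rightarrow> 'a" and xs ys :: "nat \<Rightarrow> int \<Rightarrow> 'a" and \<delta> :: "nat \<Rightarrow> nat"
  assumes x: "is_expansion \<tau> p x xs \<delta>" and y: "is_expansion \<tau> p y ys \<delta>"
begin

lemma digit_less: "\<forall>l. \<delta> l < p"
  using x unfolding is_expansion_def by blast

text \<open>Coordinates are counted in blocks from \<open>tail_start \<delta> m\<close>, where the block with index \<open>1\<close> begins;
  this accounts for the letter at \<open>q + 1\<close>.\<close>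

lemma eq_if_block_eq:
  assumes "(n - tail_start \<delta> m) div P ^ m = q" "xs m (q + 1) = ys m (q + 1)"
  shows "x n = y n"
proof -
  have "(n - tail_start \<delta> m + P ^ m) div P ^ m = q + 1"
    using assms(1) P_pos(2)[of m] by (subst div_add_self2) auto
  then show ?thesis
    unfolding expansion_iterate[OF x, of n m] expansion_iterate[OF y, of n m]
    using assms(2) by (intro S_iterate_block) auto
qed

lemma differ_if_block_differs:
  assumes "inj \<tau>" "1 \<le> j" "xs m j \<noteq> ys m j"
  shows "\<exists>n \<ge> tail_start \<delta> m. x n \<noteq> y n"
proof -
  obtain i where i: "i div P ^ m = j" "(S ^^ m) (xs m) i \<noteq> (S ^^ m) (ys m) i"
    using S_iterate_block_differs[where u = "xs m" and v = "ys m" and j = j and m = m] assms by blast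
  define n where "n = i + tail_start \<delta> m - P ^ m"
  have "x n \<noteq> y n"
    unfolding expansion_iterate[OF x, of n m] expansion_iterate[OF y, of n m]
    using i(2) by (simp add: n_def)
  moreover have "P ^ m \<le> i"
  proof -
    have "1 * P ^ m \<le> i div P ^ m * P ^ m" using assms(2) i(1) by (intro mult_right_mono) auto
    also have "\<dots> \<le> i" using div_mult_mod_eq[of i "P ^ m"] pos_mod_sign[OF P_pos(2), of i m] by linarith
    finally show ?thesis by simp
  qed
  ultimately show ?thesis by (intro exI[of _ n]) (simp add: n_def)
qed

text \<open>The image under \<open>\<tau>\<close> of any letter has the same entry in column \<open>c\<close>. So \<open>xs m\<close> and \<open>ys m\<close> agree in
  column \<open>c\<close> of the image of the letter with index \<open>1\<close> at level \<open>m + 1\<close>, and \<open>x\<close> and \<open>y\<close> agree on the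
  block of length \<open>p\<^sup>m\<close> over it.\<close>

lemma long_agreement:
  assumes "c < p" "\<And>a b. \<tau> a ! c = \<tau> b ! c"
  shows "\<exists>a\<ge>0. \<forall>n. a \<le> n \<and> n < a + int m \<longrightarrow> x n = y n"
proof -
  define a where "a = tail_start \<delta> (Suc m) + int c * P ^ m"
  define q where "q = P - 1 - int (\<delta> m) + int c"
  have "x n = y n" if n: "a \<le> n" "n < a + int m" for n
  proof (rule eq_if_block_eq)
    have a: "a = tail_start \<delta> m + P ^ m * q"
      by (simp add: a_def q_def tail_start_Suc algebra_simps)
    show "(n - tail_start \<delta> m) div P ^ m = q"
    proof (rule int_div_pos_eq)
      show "n - tail_start \<delta> m = P ^ m * q + (n - a)" using a by simp
      show "n - a < P ^ m" using n exponent_less_power[of m] by linarith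
    qed (use n in simp)
    have "(q + 1 + int (\<delta> m)) mod P = int c"
      using assms(1) by (simp add: q_def)
    then show "xs m (q + 1) = ys m (q + 1)"
      using assms(2) by (simp add: expansion_step[OF x, of m] expansion_step[OF y, of m])
  qed
  moreover have "0 \<le> a"
    using tail_start_pos[OF digit_less, of "Suc m"] by (simp add: a_def)
  ultimately show ?thesis by blast
qed

text \<open>The intervals from \<open>tail_start \<delta> i\<close> to \<open>tail_start \<delta> (Suc i)\<close> with \<open>i \<ge> N\<close> cover the half-line,
  and on each of them \<open>x\<close> and \<open>y\<close> consist of the blocks of level \<open>i\<close> over \<open>s\<^sub>i(x)\<close> and \<open>s\<^sub>i(y)\<close>.\<close>

lemma tail_agrees_if_suffixes_agree:
  assumes "infinite {l. \<delta> l < p - 1}"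
    and "\<And>i j. N \<le> i \<Longrightarrow> 1 \<le> j \<Longrightarrow> j \<le> P - 1 - int (\<delta> i) \<Longrightarrow> xs i j = ys i j"
    and n: "tail_start \<delta> N \<le> n"
  shows "x n = y n"
proof -
  have ex: "\<exists>m. n < tail_start \<delta> m"
  proof -
    obtain m where "int (nat (n + 1)) \<le> tail_start \<delta> m"
      using tail_start_unbounded[OF digit_less assms(1)] by blast
    then show ?thesis by (intro exI[of _ m]) linarith
  qed
  define m where "m = (LEAST m. n < tail_start \<delta> m)"
  have m: "n < tail_start \<delta> m" unfolding m_def using ex by (rule LeastI_ex)
  have "N < m"
    using m n tail_start_mono[OF digit_less, of m N] by (meson leI less_le_not_le order_trans)
  then obtain i where i: "m = Suc i" "N \<le> i" by (metis less_Suc_eq_le less_imp_Suc_add)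
  have "\<not> n < tail_start \<delta> i"
    using i(1) unfolding m_def by (intro not_less_Least) simp
  then have lower: "tail_start \<delta> i \<le> n" by simp
  define q where "q = (n - tail_start \<delta> i) div P ^ i"
  have "0 \<le> q" unfolding q_def using lower P_pos(2)[of i]
    by (subst pos_imp_zdiv_nonneg_iff) linarith+
  moreover have "q < P - 1 - int (\<delta> i)"
  proof -
    have "q * P ^ i \<le> n - tail_start \<delta> i"
      using div_mult_mod_eq[of "n - tail_start \<delta> i" "P ^ i"]
        pos_mod_sign[OF P_pos(2), of "n - tail_start \<delta> i" i] unfolding q_def by linarith
    also have "\<dots> < (P - 1 - int (\<delta> i)) * P ^ i"
      using m by (simp add: i tail_start_Suc)
    finally show ?thesis using P_pos(2)[of i] by (simp add: mult_less_cancel_right del: P_pos)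
  qed
  ultimately show ?thesis
    using assms(2)[OF i(2), of "q + 1"] by (intro eq_if_block_eq[where m = i and q = q]) (auto simp: q_def)
qed

text \<open>Digits \<open>p - 1\<close> put coordinate \<open>0\<close> at the end of its block on every level from \<open>N\<close> on. So
  \<open>tail_start\<close> no longer moves, the letter with index \<open>1\<close> is the first letter of an image under \<open>\<tau>\<close>, and the
  blocks over it grow to cover the half-line.\<close>

lemma tail_agrees_if_first_letters_agree:
  assumes "\<And>i. N \<le> i \<Longrightarrow> \<delta> i = p - 1" "\<And>a b. \<tau> a ! 0 = \<tau> b ! 0"
    and n: "tail_start \<delta> N \<le> n"
  shows "x n = y n"
proof -
  \<comment> \<open>A level whose block over index \<open>1\<close>, of length \<open>p\<^sup>i > i\<close>, reaches beyond \<open>n\<close>.\<close>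
  define i where "i = N + nat (n - tail_start \<delta> N)"
  have "tail_start \<delta> (N + l) = tail_start \<delta> N" for l
    using assms(1) two_le_p by (induction l) (simp_all add: tail_start_Suc of_nat_diff)
  then have t: "tail_start \<delta> i = tail_start \<delta> N" by (simp add: i_def)
  show ?thesis
  proof (rule eq_if_block_eq)
    show "(n - tail_start \<delta> i) div P ^ i = 0"
    proof (rule div_pos_pos_trivial)
      have "n - tail_start \<delta> N \<le> int i" using n by (simp add: i_def)
      then show "n - tail_start \<delta> i < P ^ i"
        using exponent_less_power[of i] unfolding t by linarith
    qed (use n in \<open>simp add: t\<close>)
    have "1 + int (\<delta> i) = P"
      using assms(1)[of i] two_le_p by (simp add: i_def of_nat_diff)
    then show "xs i (0 + 1) = ys i (0 + 1)"
      using assms(2) by (simp add: expansion_step[OF x, of i] expansion_step[OF y, of i])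
  qed
qed

end
end

theorem corollary3p11:
  fixes \<tau> :: "bit \<Rightarrow> bit list" and p :: nat
    and \<rho> :: "(int \<Rightarrow> bit) \<Rightarrow> (int \<Rightarrow> bit) \<Rightarrow> real"
    and x y :: "int \<Rightarrow> bit"
  assumes "substitution \<tau>"
    and "inj \<tau>"
    and "primitive \<tau>"
    and "p \<ge> 2"
    and "constant_length \<tau> p"
    and "coincidence \<tau>"
    and "infinite (subst_shift \<tau>)"
    and "compatible_metric (subst_shift \<tau>) \<rho>"
    and "{x, y} \<subseteq> subst_shift \<tau>"
    and "address \<tau> p x = address \<tau> p y"
  shows "(infinite (I_plus \<tau> p x) \<longrightarrow>
            (if infinite {i \<in> I_plus \<tau> p x. suffix_word \<tau> p i x \<noteq> suffix_word \<tau> p i y}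
             then Li_Yorke_pair \<rho> x y
             else asymptotic_pair \<rho> x y)) \<and>
         (finite (I_plus \<tau> p x) \<longrightarrow>
            (if hd (\<tau> 0) = hd (\<tau> 1)
             then asymptotic_pair \<rho> x y
             else (asymptotic_pair \<rho> x y \<or> Li_Yorke_pair \<rho> x y) \<and> \<not> distal_pair \<rho> x y))"
proof -
  interpret constant_length_substitution \<tau> p
    using assms by unfold_locales
  define xs ys \<delta> where "xs = desubst \<tau> p x" and "ys = desubst \<tau> p y" and "\<delta> = address \<tau> p x"
  have ex: "is_expansion \<tau> p x xs \<delta>" and ey: "is_expansion \<tau> p y ys \<delta>"
    using expansion_exists[OF assms(3), of x] expansion_exists[OF assms(3), of y] assms(9,10)
    by (simp_all add: xs_def ys_def \<delta>_def)
  note pair = ex ey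
  have X: "subshift (subst_shift \<tau>)" "compatible_metric (subst_shift \<tau>) \<rho>"
    "x \<in> subst_shift \<tau>" "y \<in> subst_shift \<tau>"
    using assms(3,8,9) language_shift_subshift by (simp_all add: subst_shift_eq_language_shift)
  have bit_const: "f a = f b" if "f 0 = f 1" for f :: "bit \<Rightarrow> bit" and a b
    using that by (cases a; cases b) auto
  have I_plus: "I_plus \<tau> p x = {i. \<delta> i < p - 1}"
    by (auto simp: I_plus_def suffix_word_def \<delta>_def)
  have suffix_eq: "suffix_word \<tau> p i x = suffix_word \<tau> p i y \<longleftrightarrow>
      (\<forall>j. 1 \<le> j \<and> j \<le> int p - 1 - int (\<delta> i) \<longrightarrow> xs i j = ys i j)" for i
    unfolding suffix_word_def assms(10)[symmetric] by (auto simp: xs_def ys_def \<delta>_def)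

  obtain a b c where c: "a \<noteq> b" "c < p" "\<tau> a ! c = \<tau> b ! c"
    using assms(5,6) by (auto simp: coincidence_def constant_length_def)
  have "\<tau> 0 ! c = \<tau> 1 ! c"
    using c by (cases a; cases b) auto
  then have coincide: "\<tau> a ! c = \<tau> b ! c" for a b
    by (rule bit_const[of "\<lambda>a. \<tau> a ! c"])
  have proximal: "proximal_pair \<rho> x y"
    using long_agreement[OF pair c(2) coincide] by (rule proximal_pair_if_long_agreement[OF X])
  have asymptotic: "asymptotic_pair \<rho> x y" if "\<And>n. tail_start \<delta> N \<le> n \<Longrightarrow> x n = y n" for N
    using that by (rule asymptotic_pair_if_eventually_agree[OF X])

  have "Li_Yorke_pair \<rho> x y"
    if inf: "infinite (I_plus \<tau> p x)"
      and diff: "infinite {i \<in> I_plus \<tau> p x. suffix_word \<tau> p i x \<noteq> suffix_word \<tau> p i y}"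
  proof -
    have "\<exists>n\<ge>N. x n \<noteq> y n" for N
    proof -
      obtain m where m: "int (nat N) \<le> tail_start \<delta> m"
        using tail_start_unbounded[OF digit_less[OF pair]] inf unfolding I_plus by metis
      obtain i where i: "m \<le> i" "suffix_word \<tau> p i x \<noteq> suffix_word \<tau> p i y"
        using diff by (auto simp: infinite_nat_iff_unbounded_le)
      then obtain j where "1 \<le> j" "xs i j \<noteq> ys i j" by (auto simp: suffix_eq)
      then obtain n where "tail_start \<delta> i \<le> n" "x n \<noteq> y n"
        using differ_if_block_differs[OF pair assms(2)] by blast
      then show ?thesis
        using m tail_start_mono[OF digit_less[OF pair] i(1)]
        by (intro exI[of _ n] conjI) linarith+
    qed
    then have "\<not> asymptotic_pair \<rho> x y"
      by (rule not_asymptotic_pair_if_frequently_differ[OF X])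
    then show ?thesis using proximal by (simp add: Li_Yorke_pair_def)
  qed
  moreover have "asymptotic_pair \<rho> x y"
    if inf: "infinite (I_plus \<tau> p x)"
      and fin: "finite {i \<in> I_plus \<tau> p x. suffix_word \<tau> p i x \<noteq> suffix_word \<tau> p i y}"
  proof -
    obtain N where N: "\<forall>i\<in>{i \<in> I_plus \<tau> p x. suffix_word \<tau> p i x \<noteq> suffix_word \<tau> p i y}. i < N"
      using fin unfolding finite_nat_set_iff_bounded by blast
    have "xs i j = ys i j" if "N \<le> i" "1 \<le> j" "j \<le> int p - 1 - int (\<delta> i)" for i j
    proof -
      have "i \<in> I_plus \<tau> p x" using that unfolding I_plus by simp
      then have "suffix_word \<tau> p i x = suffix_word \<tau> p i y" using N that(1) by fastforce
      then show ?thesis using that unfolding suffix_eq by blast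
    qed
    then show ?thesis
      using inf unfolding I_plus
      by (intro asymptotic[of N] tail_agrees_if_suffixes_agree[OF pair, where N = N]) auto
  qed
  moreover have "asymptotic_pair \<rho> x y"
    if fin: "finite (I_plus \<tau> p x)" and same: "hd (\<tau> 0) = hd (\<tau> 1)"
  proof -
    obtain N where "\<forall>i\<in>I_plus \<tau> p x. i < N"
      using fin unfolding finite_nat_set_iff_bounded by blast
    then have N: "\<delta> i = p - 1" if "N \<le> i" for i
    proof -
      have "\<not> \<delta> i < p - 1" using \<open>\<forall>i\<in>I_plus \<tau> p x. i < N\<close> that unfolding I_plus by auto
      then show ?thesis using spec[OF digit_less[OF pair], of i] by linarith
    qed
    have "hd (\<tau> a) = \<tau> a ! 0" for a
      using assms(1) by (simp add: substitution_def hd_conv_nth)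
    then have "\<tau> 0 ! 0 = \<tau> 1 ! 0"
      using same by simp
    then have "\<tau> a ! 0 = \<tau> b ! 0" for a b
      by (rule bit_const[of "\<lambda>a. \<tau> a ! 0"])
    then show ?thesis
      using N by (intro asymptotic[of N] tail_agrees_if_first_letters_agree[OF pair, where N = N]) auto
  qed
  moreover have "\<not> distal_pair \<rho> x y"
    using proximal by (simp add: proximal_pair_def distal_pair_def)
  ultimately show ?thesis using proximal by (auto simp: Li_Yorke_pair_def)
qed

end
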